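(* (Dual core-EP decomposition) Let $\widehat{A}=A+\epsilon B\in\mathbb{DR}^{n\times n}$ with dual index $\operatorname{Ind}(\widehat{A})=m$. Then $\widehat{A}$ can be expressed as $\widehat{A}=\widehat{T}+\widehat{N}$ with $\widehat{T},\widehat{N}\in\mathbb{DR}^{n\times n}$, where (i) $\operatorname{Ind}(\widehat{T})=1$, (ii) $\widehat{N}^{m}=O$, (iii) $\widehat{T}^{T}\widehat{N}=\widehat{N}\widehat{T}=O$. Moreover, the decomposition is unique.
   Context: Dual numbers are $a+\epsilon b$ with $a,b\in\mathbb{R}$, $\epsilon\neq 0$, $\epsilon^2=0$. $\mathbb{DR}^{n\times n}$ is the set of dual real matrices $\widehat{A}=A+\epsilon B$, $A,B\in\mathbb{R}^{n\times n}$, with product $(A+\epsilon B)(C+\epsilon D)=AC+\epsilon(AD+BC)$ and transpose $(A+\epsilon B)^T=A^T+\epsilon B^T$. For a real square matrix $A$, $\operatorname{Ind}(A)$ is the smallest nonnegative integer $s$ with $\operatorname{rank}(A^{s+1})=\operatorname{rank}(A^s)$. The appreciable index of $\widehat{A}=A+\epsilon B$ is $A\operatorname{Ind}(\widehat{A}):=\operatorname{Ind}(A)$. The appreciable rank $A\operatorname{rank}(\widehat{A})$ is the rank of the standard part $A$; $\operatorname{rank}(\widehat{A})$ is the number of nonzero (appreciable or infinitesimal) dual numbers on the diagonal in a dual singular value decomposition of $\widehat{A}$. If $p=A\operatorname{Ind}(\widehat{A})$, the dual index $\operatorname{Ind}(\widehat{A})$ is the least positive integer $k$ ($p\le k\le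 2p$) such that $A\operatorname{rank}(\widehat{A}^{k})=\operatorname{rank}(\widehat{A}^{k})$. *)

theory Defs
  imports "HOL-Analysis.Analysis"
begin

text \<open>Dual numbers: \<open>Dual a b\<close> stands for \<open>a + \<epsilon> b\<close> with \<open>\<epsilon>\<^sup>2 = 0\<close>, \<open>\<epsilon> \<noteq> 0\<close>.\<close>

datatype dualnum = Dual (std_part: real) (inf_part: real)

instantiation dualnum :: comm_ring_1
begin

definition zero_dualnum :: dualnum where "0 = Dual 0 0"
definition one_dualnum :: dualnum where "1 = Dual 1 0"
definition plus_dualnum :: "dualnum \<Rightarrow> dualnum \<Rightarrow> dualnum" where
  "x + y = Dual (std_part x + std_part y) (inf_part x + inf_part y)"
definition minus_dualnum :: "dualnum \<Rightarrow> dualnum \<Rightarrow> dualnum" where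
  "x - y = Dual (std_part x - std_part y) (inf_part x - inf_part y)"
definition uminus_dualnum :: "dualnum \<Rightarrow> dualnum" where
  "- x = Dual (- std_part x) (- inf_part x)"
definition times_dualnum :: "dualnum \<Rightarrow> dualnum \<Rightarrow> dualnum" where
  "x * y = Dual (std_part x * std_part y) (std_part x * inf_part y + inf_part x * std_part y)"

instance
  by standard
    (auto simp: zero_dualnum_def one_dualnum_def plus_dualnum_def minus_dualnum_def
       uminus_dualnum_def times_dualnum_def dualnum.expand algebra_simps)

end

text \<open>The usual total order on dual numbers is lexicographic: a positive dual number has a
  positive standard part, or standard part zero and a positive dual part.\<close>

instantiation dualnum :: linorder
begin

definition less_eq_dualnum :: "dualnum \<Rightarrow> dualnum \<Rightarrow> bool" where
  "x \<le> y \<longleftrightarrow> std_part x < std_part y \<or> (std_part x = std_part y \<and> inf_part x \<le> inf_part y)"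
definition less_dualnum :: "dualnum \<Rightarrow> dualnum \<Rightarrow> bool" where
  "x < y \<longleftrightarrow> std_part x < std_part y \<or> (std_part x = std_part y \<and> inf_part x < inf_part y)"

instance
  by standard (auto simp: less_eq_dualnum_def less_dualnum_def dualnum.expand)

end

lemma dualnum_parts [simp]:
  "std_part 0 = 0" "inf_part 0 = 0" "std_part 1 = 1" "inf_part 1 = 0"
  "std_part (x + y) = std_part x + std_part y" "inf_part (x + y) = inf_part x + inf_part y"
  "std_part (x * y) = std_part x * std_part y"
  "inf_part (x * y) = std_part x * inf_part y + inf_part x * std_part y"
  by (simp_all add: zero_dualnum_def one_dualnum_def plus_dualnum_def times_dualnum_def)

lemma std_part_sum: "std_part (sum f S) = (\<Sum>i\<in>S. std_part (f i))"
  by (induction S rule: infinite_finite_induct) auto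

lemma inf_part_sum: "inf_part (sum f S) = (\<Sum>i\<in>S. inf_part (f i))"
  by (induction S rule: infinite_finite_induct) auto

text \<open>Dual matrices have type \<open>dualnum^'n^'n\<close>, with the library product \<open>**\<close> and
  \<open>transpose\<close>. The lemmas below show that these are
  \<open>(A + \<epsilon> B)(C + \<epsilon> D) = AC + \<epsilon> (AD + BC)\<close> and \<open>(A + \<epsilon> B)\<^sup>T = A\<^sup>T + \<epsilon> B\<^sup>T\<close>.\<close>

definition dual_mat :: "real^'n^'m \<Rightarrow> real^'n^'m \<Rightarrow> dualnum^'n^'m" where
  "dual_mat A B = (\<chi> i j. Dual (A $ i $ j) (B $ i $ j))"

definition std_mat :: "dualnum^'n^'m \<Rightarrow> real^'n^'m" where
  "std_mat A = (\<chi> i j. std_part (A $ i $ j))"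

definition inf_mat :: "dualnum^'n^'m \<Rightarrow> real^'n^'m" where
  "inf_mat A = (\<chi> i j. inf_part (A $ i $ j))"

lemma std_mat_dual_mat [simp]: "std_mat (dual_mat A B) = A"
  by (simp add: std_mat_def dual_mat_def vec_eq_iff)

lemma inf_mat_dual_mat [simp]: "inf_mat (dual_mat A B) = B"
  by (simp add: inf_mat_def dual_mat_def vec_eq_iff)

lemma dual_mat_std_inf [simp]: "dual_mat (std_mat A) (inf_mat A) = A"
  by (simp add: std_mat_def inf_mat_def dual_mat_def vec_eq_iff)

lemma dual_mat_add: "dual_mat A B + dual_mat C D = dual_mat (A + C) (B + D)"
  by (simp add: dual_mat_def vec_eq_iff plus_dualnum_def)

lemma dual_mat_mult: "dual_mat A B ** dual_mat C D = dual_mat (A ** C) (A ** D + B ** C)"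
  by (simp add: dual_mat_def matrix_matrix_mult_def vec_eq_iff dualnum.expand
      std_part_sum inf_part_sum sum.distrib)

lemma transpose_dual_mat: "transpose (dual_mat A B) = dual_mat (transpose A) (transpose B)"
  by (simp add: dual_mat_def transpose_def vec_eq_iff)

text \<open>Matrix power. The class operation \<open>^\<close> is not usable here, since multiplication on
  vector types is componentwise.\<close>

primrec mat_pow :: "'a::semiring_1^'n^'n \<Rightarrow> nat \<Rightarrow> 'a^'n^'n" where
  "mat_pow A 0 = mat 1"
| "mat_pow A (Suc k) = A ** mat_pow A k"

definition mat_index :: "real^'n^'n \<Rightarrow> nat" where
  "mat_index A = (LEAST s. rank (mat_pow A (s + 1)) = rank (mat_pow A s))"

definition app_index :: "dualnum^'n^'n \<Rightarrow> nat" where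
  "app_index A = mat_index (std_mat A)"

definition app_rank :: "dualnum^'n^'n \<Rightarrow> nat" where
  "app_rank A = rank (std_mat A)"

text \<open>Dual singular value decomposition \<open>A = U S V\<^sup>T\<close>. The usual convention that the singular
  values are listed in decreasing order is not imposed, because the index type \<open>'n\<close> carries no
  order; it can be met by a simultaneous permutation of the columns of \<open>U\<close> and \<open>V\<close>, which
  does not change the number of nonzero diagonal entries.\<close>

definition is_dual_svd ::
  "dualnum^'n^'n \<Rightarrow> dualnum^'n^'n \<Rightarrow> dualnum^'n^'n \<Rightarrow> dualnum^'n^'n \<Rightarrow> bool" where
  "is_dual_svd A U S V \<longleftrightarrow>
     orthogonal_matrix U \<and> orthogonal_matrix V \<and>
     (\<forall>i j. i \<noteq> j \<longrightarrow> S $ i $ j = 0) \<and> (\<forall>i. 0 \<le> S $ i $ i) \<and>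
     A = U ** S ** transpose V"

definition dual_rank :: "dualnum^'n^'n \<Rightarrow> nat" where
  "dual_rank A = (THE r. \<exists>U S V. is_dual_svd A U S V \<and> r = card {i. S $ i $ i \<noteq> 0})"

text \<open>With \<open>p\<close> the appreciable index, the dual index is the least positive \<open>k\<close> with
  \<open>p \<le> k \<le> 2p\<close> and equal appreciable rank and rank of the \<open>k\<close>-th power. For invertible standard
  part, \<open>p = 0\<close> and no positive \<open>k\<close> satisfies \<open>k \<le> 2p\<close>; the index is then \<open>1\<close>, whence the
  upper bound \<open>max 1 (2p)\<close>.\<close>

definition dual_index :: "dualnum^'n^'n \<Rightarrow> nat" where
  "dual_index A = (LEAST k. 1 \<le> k \<and> app_index A \<le> k \<and> k \<le> max 1 (2 * app_index A) \<and>
     app_rank (mat_pow A k) = dual_rank (mat_pow A k))"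

end

theory Submission
  imports Defs
begin

text \<open>Write \<open>A\<^sub>0\<close> for the standard part of a dual matrix \<open>A\<close>. Over the reals, the core-EP decomposition is
  \<open>T = P A\<close>, \<open>N = (1 - P) A\<close>, where \<open>P\<close> is the orthogonal projector onto the range of \<open>A ^ m\<close> and \<open>m\<close> is
  the index: the range is invariant under \<open>A\<close>, so \<open>A P = P A P\<close>, and \<open>A\<close> acts bijectively on it. The
  same formulas work over the dual numbers as soon as \<open>A ^ m\<close> has an orthogonal projector, that is, a
  symmetric idempotent \<open>P = A ^ m Y\<close> with \<open>P A ^ m = A ^ m\<close>. Such a \<open>P\<close> does not exist for every dual
  matrix, and the dual index is made precisely so that it exists for \<open>A ^ m\<close>.

  To see this, the rank of a dual matrix has to be understood, and it is defined by the dual singular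
  value decomposition. That decomposition exists for every \<open>X\<close> (\<open>exists_dual_svd\<close>), and reading it
  off a diagonal matrix shows that the rank is \<open>n\<close> minus the dimension of the space of standard parts of
  dual kernel vectors of \<open>X\<close> (\<open>dual_rank_plus_dim_kernel\<close>); in particular it does not depend on the
  decomposition. Hence rank and appreciable rank of \<open>X\<close> agree iff every kernel vector of \<open>X\<^sub>0\<close> lifts
  to a dual kernel vector of \<open>X\<close> (\<open>app_rank_eq_dual_rank_iff\<close>). In that case every nonzero singular
  value is a unit, so the decomposition yields the projector (\<open>exists_orthogonal_projector\<close>).
  Conversely every matrix with an inner inverse has the lifting property
  (\<open>kernel_lifts_if_inner_inverse\<close>), which gives dual index one for \<open>T\<close>.

  A dual matrix is invertible iff its standard part is. Therefore bijectivity of \<open>A\<close> on the range of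
  \<open>P\<close> follows from the real statement, where it is the stabilisation of kernels of the powers of \<open>A\<^sub>0\<close>
  (\<open>invertible_on_range\<close>).

  For uniqueness, let \<open>Q\<close> be the orthogonal projector of some admissible \<open>T\<close>. Since \<open>T\<^sup>T N = 0\<close>,
  \<open>Q A = T\<close>. Expanding \<open>(T + N) ^ m\<close> with \<open>N T = 0\<close> and \<open>N ^ m = 0\<close> shows that \<open>A ^ m\<close> is a right
  multiple of \<open>T\<close>; and \<open>T\<close>, being a right multiple of \<open>T ^ (m + 1) = A ^ m T\<close>, is a right multiple of
  \<open>A ^ m\<close>. So \<open>P Q = Q\<close> and \<open>Q P = P\<close>, and symmetry of the projectors gives \<open>P = Q\<close>.\<close>

section \<open>Simultaneous singular form of two real matrices\<close>

text \<open>A dual singular value decomposition of \<open>A + \<epsilon> B\<close> needs orthogonal matrices that diagonalise \<open>A\<close> and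
  also, inside each block of equal singular values of \<open>A\<close>, the symmetric part of \<open>B\<close> (the whole of
  \<open>B\<close> in the block of the value zero). Such matrices are found variationally: the rows of \<open>U\<close> and
  \<open>V\<close> maximise the sum of \<open>w\<^sub>k u\<^sub>k \<bullet> A v\<^sub>k\<close> with distinct positive weights and, among the maximisers, the
  same sum for \<open>B\<close>. The distinct weights break the symmetry between the rows, so that one maximum
  replaces the usual induction over the singular values.\<close>

definition weighted_trace :: "('n \<Rightarrow> real) \<Rightarrow> real^'n^'n \<Rightarrow> real^'n^'n \<Rightarrow> real^'n^'n \<Rightarrow> real" where
  "weighted_trace w A U V = (\<Sum>k\<in>UNIV. w k * (U $ k \<bullet> (A *v V $ k)))"

definition rotate_rows :: "'n \<Rightarrow> 'n \<Rightarrow> real \<Rightarrow> real \<Rightarrow> real^'n^'n \<Rightarrow> real^'n^'n" where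
  "rotate_rows i j c s U = (\<chi> k. if k = i then c *\<^sub>R U $ i + s *\<^sub>R U $ j
     else if k = j then c *\<^sub>R U $ j - s *\<^sub>R U $ i else U $ k)"

definition negate_row :: "'n \<Rightarrow> real^'n^'n \<Rightarrow> real^'n^'n" where
  "negate_row i U = (\<chi> k. if k = i then - U $ i else U $ k)"

lemma orthogonal_matrix_iff_rows:
  fixes U :: "real^'n^'n"
  shows "orthogonal_matrix U \<longleftrightarrow> (\<forall>k l. U $ k \<bullet> U $ l = (if k = l then 1 else 0))"
proof -
  have "orthogonal_matrix U \<longleftrightarrow> U ** transpose U = mat 1"
    by (metis matrix_left_right_inverse orthogonal_matrix_def)
  also have "\<dots> \<longleftrightarrow> (\<forall>k l. U $ k \<bullet> U $ l = (if k = l then 1 else 0))"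
    by (simp add: matrix_mult_transpose_dot_row vec_eq_iff mat_def row_def)
  finally show ?thesis .
qed

lemma orthogonal_rotate_rows:
  fixes U :: "real^'n^'n"
  assumes "orthogonal_matrix U" "i \<noteq> j" "c\<^sup>2 + s\<^sup>2 = 1"
  shows "orthogonal_matrix (rotate_rows i j c s U)"
proof -
  have "c * c + s * s = 1" using assms(3) by (simp add: power2_eq_square)
  then show ?thesis
    using assms(1,2) unfolding orthogonal_matrix_iff_rows rotate_rows_def
    by (auto simp: inner_simps algebra_simps)
qed

lemma orthogonal_negate_row:
  fixes U :: "real^'n^'n"
  shows "orthogonal_matrix U \<Longrightarrow> orthogonal_matrix (negate_row i U)"
  unfolding orthogonal_matrix_iff_rows negate_row_def by auto

lemma rotate_rows_0 [simp]: "i \<noteq> j \<Longrightarrow> rotate_rows i j 1 0 U = U"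
  by (simp add: rotate_rows_def vec_eq_iff)

lemma weighted_trace_rotate_rows:
  fixes A U V :: "real^'n^'n"
  assumes "i \<noteq> j"
  defines "M \<equiv> \<lambda>k l. U $ k \<bullet> (A *v V $ l)"
  shows "weighted_trace w A (rotate_rows i j c s U) (rotate_rows i j c' s' V) - weighted_trace w A U V =
    w i * (c * c' * M i i + c * s' * M i j + s * c' * M j i + s * s' * M j j - M i i) +
    w j * (s * s' * M i i - s * c' * M i j - c * s' * M j i + c * c' * M j j - M j j)"
proof -
  have split: "(\<Sum>k\<in>UNIV. f k) = f i + f j + (\<Sum>k\<in>UNIV - {i,j}. f k)" for f :: "'n \<Rightarrow> real"
    using assms(1) by (simp add: sum.subset_diff[of "{i,j}" UNIV])
  have "(\<Sum>k\<in>UNIV - {i,j}. w k * (rotate_rows i j c s U $ k \<bullet> (A *v rotate_rows i j c' s' V $ k)))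
      = (\<Sum>k\<in>UNIV - {i,j}. w k * (U $ k \<bullet> (A *v V $ k)))"
    by (rule sum.cong) (auto simp: rotate_rows_def)
  then show ?thesis
    using assms(1) unfolding weighted_trace_def split
    by (simp add: rotate_rows_def M_def inner_simps matrix_vector_right_distrib
        matrix_vector_mult_diff_distrib matrix_vector_mult_scaleR algebra_simps)
qed

lemma weighted_trace_negate_row:
  fixes A U V :: "real^'n^'n"
  shows "weighted_trace w A (negate_row i U) V = weighted_trace w A U V - 2 * w i * (U $ i \<bullet> (A *v V $ i))"
proof -
  have split: "(\<Sum>k\<in>UNIV. f k) = f i + (\<Sum>k\<in>UNIV - {i}. f k)" for f :: "'n \<Rightarrow> real"
    by (simp add: sum.remove)
  have "(\<Sum>k\<in>UNIV - {i}. w k * (negate_row i U $ k \<bullet> (A *v V $ k)))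
      = (\<Sum>k\<in>UNIV - {i}. w k * (U $ k \<bullet> (A *v V $ k)))"
    by (rule sum.cong) (auto simp: negate_row_def)
  then show ?thesis
    unfolding weighted_trace_def split by (simp add: negate_row_def)
qed

text \<open>The first-order condition at angle zero in trigonometric form: the left side is of first order in the
  angle and the right side of second order.\<close>

lemma rotation_bound_imp_zero:
  fixes a b :: real
  assumes "\<And>c s. c\<^sup>2 + s\<^sup>2 = 1 \<Longrightarrow> b * (c * s) \<le> a * s\<^sup>2"
  shows "b = 0"
proof (rule ccontr)
  assume "b \<noteq> 0"
  \<comment> \<open>The angle with tangent \<open>b / (\<bar>a\<bar> + 1)\<close> violates the bound.\<close>
  define r where "r = sqrt (b\<^sup>2 + (\<bar>a\<bar> + 1)\<^sup>2)"
  have r: "r > 0" "r\<^sup>2 = b\<^sup>2 + (\<bar>a\<bar> + 1)\<^sup>2"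
    unfolding r_def using \<open>b \<noteq> 0\<close> by (auto simp: add_pos_nonneg)
  have "((\<bar>a\<bar> + 1) / r)\<^sup>2 + (b / r)\<^sup>2 = (b\<^sup>2 + (\<bar>a\<bar> + 1)\<^sup>2) / r\<^sup>2"
    unfolding power_divide unfolding add_divide_distrib[symmetric] by (simp only: add.commute)
  also have "\<dots> = r\<^sup>2 / r\<^sup>2" by (simp only: r(2))
  also have "\<dots> = 1" using r(1) by simp
  finally have "((\<bar>a\<bar> + 1) / r)\<^sup>2 + (b / r)\<^sup>2 = 1" .
  note assms[OF this]
  moreover have "b * ((\<bar>a\<bar> + 1) / r * (b / r)) = b\<^sup>2 * (\<bar>a\<bar> + 1) / r\<^sup>2"
    by (simp add: power2_eq_square)
  moreover have "a * (b / r)\<^sup>2 = a * b\<^sup>2 / r\<^sup>2" by (simp add: power_divide)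
  ultimately have "b\<^sup>2 * (\<bar>a\<bar> + 1) / r\<^sup>2 \<le> a * b\<^sup>2 / r\<^sup>2" by (simp only:)
  then have "b\<^sup>2 * (\<bar>a\<bar> + 1) \<le> a * b\<^sup>2"
    using r(1) by (simp add: divide_le_cancel)
  moreover have "b\<^sup>2 > 0" using \<open>b \<noteq> 0\<close> by simp
  ultimately have "\<bar>a\<bar> + 1 \<le> a" by (simp add: mult.commute)
  then show False by simp
qed

text \<open>Doubling the angle turns \<open>1 - c\<close> and \<open>s\<close> into \<open>2 s\<^sup>2\<close> and \<open>2 c s\<close>, the shape of the previous bound.\<close>

lemma rotation_bound_imp_zero_linear:
  fixes a b :: real
  assumes "\<And>c s. c\<^sup>2 + s\<^sup>2 = 1 \<Longrightarrow> a * (c - 1) + b * s \<le> 0"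
  shows "b = 0"
proof (rule rotation_bound_imp_zero)
  fix c s :: real
  assume cs: "c\<^sup>2 + s\<^sup>2 = 1"
  have "(c\<^sup>2 - s\<^sup>2)\<^sup>2 + (2 * c * s)\<^sup>2 = (c\<^sup>2 + s\<^sup>2)\<^sup>2"
    by (simp add: power2_eq_square algebra_simps)
  then have "(c\<^sup>2 - s\<^sup>2)\<^sup>2 + (2 * c * s)\<^sup>2 = 1" using cs by simp
  from assms[OF this] have "a * (c\<^sup>2 - s\<^sup>2 - 1) + b * (2 * c * s) \<le> 0" .
  moreover have "c\<^sup>2 - s\<^sup>2 - 1 = - 2 * s\<^sup>2" using cs by simp
  ultimately have "a * (- 2 * s\<^sup>2) + b * (2 * c * s) \<le> 0" by metis
  then show "b * (c * s) \<le> a * s\<^sup>2" by (simp add: algebra_simps)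
qed

text \<open>With \<open>M\<close> the matrix of \<open>A\<close> between the rows of \<open>U\<close> and \<open>V\<close>, rotating the rows of \<open>U\<close> alone gives
  \<open>w\<^sub>i M\<^sub>j\<^sub>i = w\<^sub>j M\<^sub>i\<^sub>j\<close>, and rotating those of \<open>V\<close> alone gives \<open>w\<^sub>i M\<^sub>i\<^sub>j = w\<^sub>j M\<^sub>j\<^sub>i\<close>. These force
  \<open>M\<^sub>i\<^sub>j = 0\<close> because \<open>w\<^sub>i\<^sup>2 \<noteq> w\<^sub>j\<^sup>2\<close>.\<close>

lemma critical_imp_off_diagonal_zero:
  fixes A U V :: "real^'n^'n"
  assumes "i \<noteq> j" and w: "w i > 0" "w j > 0" "w i \<noteq> w j"
    and left: "\<And>c s. c\<^sup>2 + s\<^sup>2 = 1 \<Longrightarrow> weighted_trace w A (rotate_rows i j c s U) V \<le> weighted_trace w A U V"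
    and right: "\<And>c s. c\<^sup>2 + s\<^sup>2 = 1 \<Longrightarrow> weighted_trace w A U (rotate_rows i j c s V) \<le> weighted_trace w A U V"
  shows "U $ i \<bullet> (A *v V $ j) = 0"
proof -
  define M where "M k l = U $ k \<bullet> (A *v V $ l)" for k l
  have "w i * M j i - w j * M i j = 0"
  proof (rule rotation_bound_imp_zero_linear[where a = "w i * M i i + w j * M j j"])
    fix c s :: real
    assume "c\<^sup>2 + s\<^sup>2 = 1"
    from left[OF this] show "(w i * M i i + w j * M j j) * (c - 1) + (w i * M j i - w j * M i j) * s \<le> 0"
      using weighted_trace_rotate_rows[OF \<open>i \<noteq> j\<close>, of w A c s U 1 0 V] \<open>i \<noteq> j\<close>
      by (simp add: M_def algebra_simps)
  qed
  moreover have "w i * M i j - w j * M j i = 0"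
  proof (rule rotation_bound_imp_zero_linear[where a = "w i * M i i + w j * M j j"])
    fix c s :: real
    assume "c\<^sup>2 + s\<^sup>2 = 1"
    from right[OF this] show "(w i * M i i + w j * M j j) * (c - 1) + (w i * M i j - w j * M j i) * s \<le> 0"
      using weighted_trace_rotate_rows[OF \<open>i \<noteq> j\<close>, of w A 1 0 U c s V] \<open>i \<noteq> j\<close>
      by (simp add: M_def algebra_simps)
  qed
  ultimately have "w i * M j i = w j * M i j" "w i * M i j = w j * M j i" by auto
  then have "w i * (w i * M i j) = w j * (w j * M i j)"
    by (metis mult.left_commute)
  then have "(w i - w j) * (w i + w j) * M i j = 0"
    by (simp add: algebra_simps)
  then show ?thesis using w by (simp add: M_def)
qed

lemma compact_orthogonal_matrices: "compact {U :: real^'n^'n. orthogonal_matrix U}"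
proof -
  have "closed {U :: real^'n^'n. orthogonal_matrix U}"
  proof -
    have "{U :: real^'n^'n. orthogonal_matrix U} =
        (\<Inter>k. \<Inter>l. {U. U $ k \<bullet> U $ l = (if k = l then 1 else 0)})"
      by (auto simp: orthogonal_matrix_iff_rows)
    also have "closed \<dots>"
      by (intro closed_INT ballI closed_Collect_eq continuous_intros)
    finally show ?thesis .
  qed
  moreover have "bounded {U :: real^'n^'n. orthogonal_matrix U}"
    unfolding bounded_iff
  proof (intro exI ballI)
    fix U :: "real^'n^'n"
    assume "U \<in> {U. orthogonal_matrix U}"
    then have "norm (U $ k) = 1" for k
      by (simp add: orthogonal_matrix_iff_rows norm_eq_1)
    then show "norm U \<le> real CARD('n)"
      using L2_set_le_sum[of UNIV "\<lambda>k. norm (U $ k)"] by (simp add: norm_vec_def)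
  qed
  ultimately show ?thesis by (simp add: compact_eq_bounded_closed)
qed

lemma exists_lexicographic_maximiser:
  fixes A B :: "real^'n^'n"
  obtains U V where "orthogonal_matrix U" "orthogonal_matrix V"
    and "\<And>U' V'. orthogonal_matrix U' \<Longrightarrow> orthogonal_matrix V' \<Longrightarrow> weighted_trace w A U' V' \<le> weighted_trace w A U V"
    and "\<And>U' V'. orthogonal_matrix U' \<Longrightarrow> orthogonal_matrix V' \<Longrightarrow> weighted_trace w A U' V' = weighted_trace w A U V
      \<Longrightarrow> weighted_trace w B U' V' \<le> weighted_trace w B U V"
proof -
  define K where "K = {U :: real^'n^'n. orthogonal_matrix U} \<times> {V :: real^'n^'n. orthogonal_matrix V}"
  have K: "compact K" unfolding K_def by (intro compact_Times compact_orthogonal_matrices)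
  have "(mat 1, mat 1) \<in> K" by (simp add: K_def orthogonal_matrix_id)
  then have ne: "K \<noteq> {}" by blast
  have cont: "continuous_on S (\<lambda>(U, V). weighted_trace w C U V)" for S :: "((real^'n^'n) \<times> (real^'n^'n)) set" and C
    unfolding weighted_trace_def case_prod_unfold matrix_vector_mult_def
    by (intro continuous_intros)
  obtain P where P: "P \<in> K" "\<forall>Q\<in>K. (\<lambda>(U, V). weighted_trace w A U V) Q \<le> (\<lambda>(U, V). weighted_trace w A U V) P"
    using continuous_attains_sup[OF K ne cont] by blast
  define L where "L = K \<inter> {Q. (\<lambda>(U, V). weighted_trace w A U V) Q = (\<lambda>(U, V). weighted_trace w A U V) P}"
  have "closed {Q. (\<lambda>(U, V). weighted_trace w A U V) Q = (\<lambda>(U, V). weighted_trace w A U V) P}"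
    by (intro closed_Collect_eq cont continuous_on_const)
  then have L: "compact L" unfolding L_def by (intro compact_Int_closed K)
  have "P \<in> L" using P by (simp add: L_def)
  then have "L \<noteq> {}" by blast
  obtain Q where Q: "Q \<in> L" "\<forall>R\<in>L. (\<lambda>(U, V). weighted_trace w B U V) R \<le> (\<lambda>(U, V). weighted_trace w B U V) Q"
    using continuous_attains_sup[OF L \<open>L \<noteq> {}\<close> cont] by blast
  show thesis
  proof (rule that[of "fst Q" "snd Q"])
    fix U' V' :: "real^'n^'n"
    assume "orthogonal_matrix U'" "orthogonal_matrix V'" "weighted_trace w A U' V' = weighted_trace w A (fst Q) (snd Q)"
    then have "(U', V') \<in> L" using Q(1) by (simp add: L_def K_def case_prod_unfold)
    then show "weighted_trace w B U' V' \<le> weighted_trace w B (fst Q) (snd Q)" using Q(2)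
      by (metis (mono_tags, lifting) case_prod_conv case_prod_unfold)
  qed (use P Q(1) in \<open>auto simp: L_def K_def case_prod_unfold\<close>)
qed

text \<open>Each property compares a lexicographic maximiser with a rotated or sign-changed pair. Those for \<open>B\<close>
  come from changes that keep the sum for \<open>A\<close>: rotating both families by the same angle when
  \<open>\<sigma>\<^sub>i = \<sigma>\<^sub>j\<close>, rotating one of them when \<open>\<sigma>\<^sub>i = \<sigma>\<^sub>j = 0\<close>, and changing the sign of a row when \<open>\<sigma>\<^sub>i = 0\<close>.\<close>

lemma simultaneous_singular_form:
  fixes A B :: "real^'n^'n"
  obtains U V where "orthogonal_matrix U" "orthogonal_matrix V"
    and "\<And>i j. i \<noteq> j \<Longrightarrow> (U ** A ** transpose V) $ i $ j = 0"
    and "\<And>i. (U ** A ** transpose V) $ i $ i \<ge> 0"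
    and "\<And>i j. i \<noteq> j \<Longrightarrow> (U ** A ** transpose V) $ i $ i = (U ** A ** transpose V) $ j $ j
      \<Longrightarrow> (U ** B ** transpose V) $ i $ j + (U ** B ** transpose V) $ j $ i = 0"
    and "\<And>i j. i \<noteq> j \<Longrightarrow> (U ** A ** transpose V) $ i $ i = 0 \<Longrightarrow> (U ** A ** transpose V) $ j $ j = 0
      \<Longrightarrow> (U ** B ** transpose V) $ i $ j = 0"
    and "\<And>i. (U ** A ** transpose V) $ i $ i = 0 \<Longrightarrow> (U ** B ** transpose V) $ i $ i \<ge> 0"
proof -
  obtain f :: "'n \<Rightarrow> nat" where "inj f"
    using finite_imp_inj_to_nat_seg[of "UNIV :: 'n set"] by auto
  define w where "w k = real (Suc (f k))" for k
  have wpos: "w k > 0" for k by (simp add: w_def)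
  have wneq: "w k \<noteq> w l" if "k \<noteq> l" for k l
    using that \<open>inj f\<close> by (auto simp: w_def inj_def)
  obtain U V where U: "orthogonal_matrix U" and V: "orthogonal_matrix V"
    and maxA: "\<And>U' V'. orthogonal_matrix U' \<Longrightarrow> orthogonal_matrix V' \<Longrightarrow> weighted_trace w A U' V' \<le> weighted_trace w A U V"
    and maxB: "\<And>U' V'. orthogonal_matrix U' \<Longrightarrow> orthogonal_matrix V' \<Longrightarrow> weighted_trace w A U' V' = weighted_trace w A U V
      \<Longrightarrow> weighted_trace w B U' V' \<le> weighted_trace w B U V"
    using exists_lexicographic_maximiser[of w A B] by blast
  have entry: "(U ** C ** transpose V) $ i $ j = U $ i \<bullet> (C *v V $ j)" for C i j
    by (simp add: matrix_mul_assoc[symmetric])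
      (simp add: matrix_matrix_mult_def matrix_vector_mult_def inner_vec_def transpose_def)
  define M where "M i j = U $ i \<bullet> (A *v V $ j)" for i j
  define C where "C i j = U $ i \<bullet> (B *v V $ j)" for i j
  have diag: "M i j = 0" if "i \<noteq> j" for i j
    unfolding M_def
    by (rule critical_imp_off_diagonal_zero[of i j w])
      (use that wpos wneq U V in \<open>auto intro!: maxA orthogonal_rotate_rows\<close>)
  have nonneg: "M i i \<ge> 0" for i
  proof -
    have "2 * w i * M i i \<ge> 0"
      using maxA[OF orthogonal_negate_row[OF U] V, of i] by (simp add: weighted_trace_negate_row M_def)
    then show ?thesis using wpos[of i] by (simp add: zero_le_mult_iff)
  qed
  have skew: "C i j + C j i = 0" if ij: "i \<noteq> j" and eq: "M i i = M j j" for i j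
  proof -
    have "(w i - w j) * (C i j + C j i) = 0"
    proof (rule rotation_bound_imp_zero[where a = "(w i - w j) * (C i i - C j j)"])
      fix c s :: real
      assume cs: "c\<^sup>2 + s\<^sup>2 = 1"
      then have c2: "c * c = 1 - s * s" by (simp add: power2_eq_square)
      let ?U = "rotate_rows i j c s U" and ?V = "rotate_rows i j c s V"
      have "weighted_trace w A ?U ?V = weighted_trace w A U V"
        using weighted_trace_rotate_rows[OF ij, of w A c s U c s V] diag[OF ij] diag[OF ij[symmetric]] eq c2
        by (simp add: M_def algebra_simps)
      then have "weighted_trace w B ?U ?V \<le> weighted_trace w B U V"
        by (intro maxB orthogonal_rotate_rows U V ij cs)
      then have "w i * (c * c * C i i + c * s * C i j + s * c * C j i + s * s * C j j - C i i) +
        w j * (s * s * C i i - s * c * C i j - c * s * C j i + c * c * C j j - C j j) \<le> 0"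
        using weighted_trace_rotate_rows[OF ij, of w B c s U c s V] by (simp add: C_def)
      then show "(w i - w j) * (C i j + C j i) * (c * s) \<le> (w i - w j) * (C i i - C j j) * s\<^sup>2"
        unfolding c2 power2_eq_square by (simp add: algebra_simps)
    qed
    then show ?thesis using wneq[OF ij] by simp
  qed
  have zero: "C i j = 0" if ij: "i \<noteq> j" and "M i i = 0" "M j j = 0" for i j
    unfolding C_def
  proof (rule critical_imp_off_diagonal_zero[of i j w, OF ij wpos wpos wneq[OF ij]])
    fix c s :: real
    assume cs: "c\<^sup>2 + s\<^sup>2 = 1"
    have "weighted_trace w A (rotate_rows i j c s U) V = weighted_trace w A U V"
      using weighted_trace_rotate_rows[OF ij, of w A c s U 1 0 V] diag[OF ij] diag[OF ij[symmetric]] that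
      by (simp add: M_def)
    then show "weighted_trace w B (rotate_rows i j c s U) V \<le> weighted_trace w B U V"
      by (intro maxB orthogonal_rotate_rows U V ij cs)
    have "weighted_trace w A U (rotate_rows i j c s V) = weighted_trace w A U V"
      using weighted_trace_rotate_rows[OF ij, of w A 1 0 U c s V] diag[OF ij] diag[OF ij[symmetric]] that
      by (simp add: M_def)
    then show "weighted_trace w B U (rotate_rows i j c s V) \<le> weighted_trace w B U V"
      by (intro maxB orthogonal_rotate_rows U V ij cs)
  qed
  have nonneg': "C i i \<ge> 0" if "M i i = 0" for i
  proof -
    have "weighted_trace w A (negate_row i U) V = weighted_trace w A U V"
      using that by (simp add: weighted_trace_negate_row M_def)
    then have "weighted_trace w B (negate_row i U) V \<le> weighted_trace w B U V"
      by (intro maxB orthogonal_negate_row U V)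
    then have "2 * w i * C i i \<ge> 0" by (simp add: weighted_trace_negate_row C_def)
    then show ?thesis using wpos[of i] by (simp add: zero_le_mult_iff)
  qed
  show thesis
    by (rule that[OF U V]; unfold entry; fold M_def C_def)
      (use diag nonneg skew zero nonneg' in auto)
qed

section \<open>The dual singular value decomposition\<close>

lemma dual_mat_eq_iff [simp]: "dual_mat A B = dual_mat C D \<longleftrightarrow> A = C \<and> B = D"
  using std_mat_dual_mat inf_mat_dual_mat by metis

lemma dual_mat_one: "mat 1 = dual_mat (mat 1) 0"
  by (simp add: dual_mat_def mat_def vec_eq_iff zero_dualnum_def one_dualnum_def)

lemma std_mat_mult [simp]: "std_mat (A ** B) = std_mat A ** std_mat B"
  by (simp add: std_mat_def matrix_matrix_mult_def vec_eq_iff std_part_sum)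

lemma std_mat_one [simp]: "std_mat (mat 1) = mat 1"
  by (simp add: std_mat_def mat_def vec_eq_iff)

lemma std_mat_transpose [simp]: "std_mat (transpose A) = transpose (std_mat A)"
  by (simp add: std_mat_def transpose_def vec_eq_iff)

lemma std_mat_orthogonal: "orthogonal_matrix U \<Longrightarrow> orthogonal_matrix (std_mat U)"
  unfolding orthogonal_matrix_def
  by (simp flip: std_mat_mult std_mat_one std_mat_transpose)

lemma transpose_zero [simp]: "transpose 0 = 0"
  by (simp add: transpose_def vec_eq_iff)

lemma orthogonal_dual_mat_real:
  "orthogonal_matrix U \<Longrightarrow> orthogonal_matrix (dual_mat U 0)"
  by (simp add: orthogonal_matrix_def transpose_dual_mat dual_mat_mult dual_mat_one)

text \<open>Skew matrices are the infinitesimal rotations: the dual orthogonal matrices with standard part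
  \<open>1\<close> are the \<open>1 + \<epsilon> P\<close> with \<open>P\<close> skew.\<close>

lemma orthogonal_one_plus_eps_skew:
  assumes "transpose P = - P"
  shows "orthogonal_matrix (dual_mat (mat 1) P)"
  using assms by (simp add: orthogonal_matrix_def transpose_dual_mat dual_mat_mult dual_mat_one)

lemma orthogonal_matrix_mult:
  fixes U V :: "'a::comm_semiring_1^'n^'n"
  assumes "orthogonal_matrix U" "orthogonal_matrix V"
  shows "orthogonal_matrix (U ** V)"
proof -
  have "transpose (U ** V) ** (U ** V) = transpose V ** (transpose U ** U) ** V"
    "(U ** V) ** transpose (U ** V) = U ** (V ** transpose V) ** transpose U"
    by (simp_all only: matrix_transpose_mul matrix_mul_assoc)
  then show ?thesis using assms by (simp add: orthogonal_matrix_def)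
qed

text \<open>Solutions \<open>p\<close>, \<open>q\<close> of the pair of equations \<open>c = p b - a q\<close>, \<open>d = q b - a p\<close> for two opposite
  off-diagonal entries \<open>c\<close>, \<open>d\<close> of the infinitesimal part in the rows of the singular values \<open>a\<close>,
  \<open>b\<close>. The determinant is \<open>b\<^sup>2 - a\<^sup>2\<close>. For \<open>a = b\<close> the equations are consistent only if \<open>c + d = 0\<close>, and
  then \<open>q = 0\<close> is one choice. For \<open>a = b = 0\<close> they force \<open>c = 0\<close>, and the value \<open>c / 0 = 0\<close> serves.\<close>

definition left_angle :: "real \<Rightarrow> real \<Rightarrow> real \<Rightarrow> real \<Rightarrow> real" where
  "left_angle a b c d = (if a = b then c / a else (c * b + d * a) / (b\<^sup>2 - a\<^sup>2))"

definition right_angle :: "real \<Rightarrow> real \<Rightarrow> real \<Rightarrow> real \<Rightarrow> real" where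
  "right_angle a b c d = (if a = b then 0 else (c * a + d * b) / (b\<^sup>2 - a\<^sup>2))"

lemma left_angle_skew:
  assumes "a = b \<Longrightarrow> c + d = 0"
  shows "left_angle b a d c = - left_angle a b c d"
proof (cases "a = b")
  case True
  then have "d = - c" using assms by simp
  then show ?thesis using True by (simp add: left_angle_def)
next
  case False
  have "(d * a + c * b) / (a\<^sup>2 - b\<^sup>2) = - ((c * b + d * a) / (b\<^sup>2 - a\<^sup>2))"
    by (metis add.commute minus_diff_eq divide_minus_right)
  then show ?thesis using False by (simp only: left_angle_def if_False False[symmetric] simp_thms)
qed

lemma right_angle_skew: "right_angle b a d c = - right_angle a b c d"
proof (cases "a = b")
  case False
  have "(d * b + c * a) / (a\<^sup>2 - b\<^sup>2) = - ((c * a + d * b) / (b\<^sup>2 - a\<^sup>2))"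
    by (metis add.commute minus_diff_eq divide_minus_right)
  then show ?thesis using False by (simp only: right_angle_def if_False False[symmetric] simp_thms)
qed (simp add: right_angle_def)

lemma left_right_angle:
  assumes "a \<ge> 0" "b \<ge> 0" "a = b \<Longrightarrow> c + d = 0" "a = 0 \<Longrightarrow> b = 0 \<Longrightarrow> c = 0"
  shows "left_angle a b c d * b - a * right_angle a b c d = c"
proof (cases "a = b")
  case True
  then show ?thesis using assms by (auto simp: left_angle_def right_angle_def)
next
  case False
  then have "b\<^sup>2 - a\<^sup>2 \<noteq> 0" using assms(1,2) by simp
  then show ?thesis using False
    by (simp add: left_angle_def right_angle_def divide_simps) (simp add: power2_eq_square algebra_simps)
qed

text \<open>Multiplying the simultaneous singular form by \<open>1 + \<epsilon> P\<close> on the left and \<open>(1 + \<epsilon> Q)\<^sup>T\<close> on the right,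
  with \<open>P\<close>, \<open>Q\<close> skew, changes the infinitesimal part by \<open>P \<Sigma> - \<Sigma> Q\<close> only, and such terms reach every
  off-diagonal entry that the simultaneous form leaves over.\<close>

lemma exists_dual_svd:
  fixes X :: "dualnum^'n^'n"
  shows "\<exists>U S V. is_dual_svd X U S V"
proof -
  define A B where "A = std_mat X" and "B = inf_mat X"
  obtain U V where U: "orthogonal_matrix U" and V: "orthogonal_matrix V"
    and offA: "\<And>i j. i \<noteq> j \<Longrightarrow> (U ** A ** transpose V) $ i $ j = 0"
    and posA: "\<And>i. (U ** A ** transpose V) $ i $ i \<ge> 0"
    and skewB: "\<And>i j. i \<noteq> j \<Longrightarrow> (U ** A ** transpose V) $ i $ i = (U ** A ** transpose V) $ j $ j
      \<Longrightarrow> (U ** B ** transpose V) $ i $ j + (U ** B ** transpose V) $ j $ i = 0"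
    and offB: "\<And>i j. i \<noteq> j \<Longrightarrow> (U ** A ** transpose V) $ i $ i = 0 \<Longrightarrow> (U ** A ** transpose V) $ j $ j = 0
      \<Longrightarrow> (U ** B ** transpose V) $ i $ j = 0"
    and posB: "\<And>i. (U ** A ** transpose V) $ i $ i = 0 \<Longrightarrow> (U ** B ** transpose V) $ i $ i \<ge> 0"
    using simultaneous_singular_form[of A B] by blast
  define S0 C where "S0 = U ** A ** transpose V" and "C = U ** B ** transpose V"
  define \<sigma> where "\<sigma> i = S0 $ i $ i" for i
  have S0: "S0 = (\<chi> i j. if i = j then \<sigma> i else 0)"
    using offA by (auto simp: vec_eq_iff \<sigma>_def S0_def)
  define D :: "real^'n^'n" where "D = (\<chi> i j. if i = j then C $ i $ i else 0)"
  define P :: "real^'n^'n" where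
    "P = (\<chi> i j. if i = j then 0 else left_angle (\<sigma> i) (\<sigma> j) (C $ i $ j) (C $ j $ i))"
  define Q :: "real^'n^'n" where
    "Q = (\<chi> i j. if i = j then 0 else right_angle (\<sigma> i) (\<sigma> j) (C $ i $ j) (C $ j $ i))"
  have pos: "\<sigma> i \<ge> 0" for i using posA[of i] by (simp add: \<sigma>_def S0_def)
  have skew: "C $ i $ j + C $ j $ i = 0" if "i \<noteq> j" "\<sigma> i = \<sigma> j" for i j
    using that unfolding S0_def C_def \<sigma>_def by (rule skewB)
  have off: "C $ i $ j = 0" if "i \<noteq> j" "\<sigma> i = 0" "\<sigma> j = 0" for i j
    using that unfolding S0_def C_def \<sigma>_def by (rule offB)
  have P: "transpose P = - P"
  proof -
    have "P $ j $ i = - P $ i $ j" for i j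
      using left_angle_skew[of "\<sigma> i" "\<sigma> j" "C $ i $ j" "C $ j $ i"] skew[of i j]
      by (cases "i = j") (simp_all add: P_def)
    then show ?thesis
      unfolding vec_eq_iff transpose_def vec_lambda_beta vector_uminus_component by blast
  qed
  have Q: "transpose Q = - Q"
  proof -
    have "Q $ j $ i = - Q $ i $ j" for i j
      using right_angle_skew[of "\<sigma> j" "\<sigma> i" "C $ j $ i" "C $ i $ j"]
      by (cases "i = j") (simp_all add: Q_def)
    then show ?thesis
      unfolding vec_eq_iff transpose_def vec_lambda_beta vector_uminus_component by blast
  qed
  have CC: "C = D + (P ** S0 + S0 ** transpose Q)"
  proof -
    have "C $ i $ j = D $ i $ j + (P $ i $ j * \<sigma> j - \<sigma> i * Q $ i $ j)" for i j
    proof (cases "i = j")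
      case True
      then show ?thesis by (simp add: D_def P_def Q_def)
    next
      case False
      then show ?thesis
        using left_right_angle[OF pos pos skew[OF False] off[OF False]]
        by (simp add: D_def P_def Q_def)
    qed
    moreover have "(Z ** S0) $ i $ j = Z $ i $ j * \<sigma> j" for Z :: "real^'n^'n" and i j
      unfolding S0 by (simp add: matrix_matrix_mult_def if_distrib[of "\<lambda>x. _ * x"] cong: if_cong)
    moreover have "(S0 ** Z) $ i $ j = \<sigma> i * Z $ i $ j" for Z :: "real^'n^'n" and i j
      unfolding S0 by (simp add: matrix_matrix_mult_def if_distrib[of "\<lambda>x. x * _"] cong: if_cong)
    ultimately show ?thesis
      unfolding Q vec_eq_iff vector_add_component vector_uminus_component by simp
  qed
  have UX: "U ** transpose U = mat 1" "transpose U ** U = mat 1" "V ** transpose V = mat 1" "transpose V ** V = mat 1"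
    using U V by (auto simp: orthogonal_matrix_def)
  have cancel: "transpose U ** (U ** Z ** transpose V) ** V = Z" for Z
  proof -
    have "transpose U ** (U ** Z ** transpose V) ** V = (transpose U ** U) ** Z ** (transpose V ** V)"
      by (simp only: matrix_mul_assoc)
    then show ?thesis using UX by simp
  qed
  let ?U = "dual_mat (transpose U) 0 ** dual_mat (mat 1) P"
  let ?V = "dual_mat (transpose V) 0 ** dual_mat (mat 1) Q"
  have "?U ** dual_mat S0 D ** transpose ?V =
      dual_mat (transpose U) 0 ** (dual_mat (mat 1) P ** dual_mat S0 D ** transpose (dual_mat (mat 1) Q)) ** dual_mat V 0"
    by (simp add: matrix_transpose_mul transpose_dual_mat matrix_mul_assoc)
  also have "\<dots> = dual_mat (transpose U) 0 ** dual_mat S0 C ** dual_mat V 0"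
    by (simp add: transpose_dual_mat dual_mat_mult CC add_ac)
  also have "\<dots> = dual_mat (transpose U ** S0 ** V) (transpose U ** C ** V)"
    by (simp add: dual_mat_mult)
  also have "\<dots> = X" by (simp add: S0_def C_def cancel) (simp add: A_def B_def)
  finally have "X = ?U ** dual_mat S0 D ** transpose ?V" by simp
  moreover have "orthogonal_matrix ?U" "orthogonal_matrix ?V"
    using P Q U V by (auto intro!: orthogonal_matrix_mult orthogonal_dual_mat_real orthogonal_one_plus_eps_skew)
  moreover have "0 \<le> dual_mat S0 D $ i $ i" for i
    using posA[of i] posB[of i]
    by (auto simp: dual_mat_def less_eq_dualnum_def D_def C_def S0_def)
  moreover have "dual_mat S0 D $ i $ j = 0" if "i \<noteq> j" for i j
    using that by (simp add: dual_mat_def S0 D_def zero_dualnum_def)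
  ultimately show ?thesis unfolding is_dual_svd_def by blast
qed

section \<open>Rank and the liftability of the real kernel\<close>

definition std_vec :: "dualnum^'n \<Rightarrow> real^'n" where
  "std_vec z = (\<chi> i. std_part (z $ i))"

definition dual_vec :: "real^'n \<Rightarrow> real^'n \<Rightarrow> dualnum^'n" where
  "dual_vec x y = (\<chi> i. Dual (x $ i) (y $ i))"

lemma std_vec_dual_vec [simp]: "std_vec (dual_vec x y) = x"
  by (simp add: std_vec_def dual_vec_def vec_eq_iff)

lemma std_vec_zero [simp]: "std_vec 0 = 0"
  by (simp add: std_vec_def vec_eq_iff)

lemma std_vec_diff [simp]: "std_vec (x - y) = std_vec x - std_vec y"
  by (simp add: std_vec_def vec_eq_iff minus_dualnum_def)

lemma std_vec_mult [simp]: "std_vec (X *v z) = std_mat X *v std_vec z"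
  by (simp add: std_vec_def std_mat_def matrix_vector_mult_def vec_eq_iff std_part_sum)

lemma std_vec_eq_0E:
  assumes "std_vec v = 0"
  obtains w where "v = dual_vec 0 w"
proof
  show "v = dual_vec 0 (\<chi> i. inf_part (v $ i))"
    using assms by (simp add: std_vec_def dual_vec_def vec_eq_iff dualnum.expand)
qed

lemma mult_dual_vec_infinitesimal: "X *v dual_vec 0 w = dual_vec 0 (std_mat X *v w)"
  by (simp add: dual_vec_def std_mat_def matrix_vector_mult_def vec_eq_iff dualnum.expand
      std_part_sum inf_part_sum)

text \<open>Kernel vectors are counted through their standard parts because the dual kernel need not be free
  over the dual numbers: an infinitesimal singular value annihilates all infinitesimal multiples of
  its singular vector, but not the vector itself.\<close>

definition dual_kernel_std :: "dualnum^'n^'n \<Rightarrow> (real^'n) set" where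
  "dual_kernel_std X = std_vec ` {z. X *v z = 0}"

lemma dual_kernel_std_subset: "dual_kernel_std X \<subseteq> {x. std_mat X *v x = 0}"
  unfolding dual_kernel_std_def by (auto simp: std_vec_mult[symmetric] simp del: std_vec_mult)

lemma diagonal_mult_vec:
  assumes "\<And>i j. i \<noteq> j \<Longrightarrow> S $ i $ j = (0 :: 'a::comm_ring_1)"
  shows "(S *v z) $ i = S $ i $ i * z $ i"
proof -
  have "(S *v z) $ i = (\<Sum>j\<in>UNIV. S $ i $ j * z $ j)"
    by (simp add: matrix_vector_mult_def)
  also have "\<dots> = (\<Sum>j\<in>UNIV. if j = i then S $ i $ i * z $ i else 0)"
    by (rule sum.cong) (auto simp: assms)
  finally have "(S *v z) $ i = (\<Sum>j\<in>UNIV. if j = i then S $ i $ i * z $ i else 0)" .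
  then show ?thesis by simp
qed

text \<open>A nonzero dual number, appreciable or infinitesimal, annihilates only dual numbers with standard part
  zero; hence both kinds of nonzero singular value count alike.\<close>

lemma dual_kernel_std_diagonal:
  fixes S :: "dualnum^'n^'n"
  assumes diag: "\<And>i j. i \<noteq> j \<Longrightarrow> S $ i $ j = 0"
  shows "dual_kernel_std S = {x. \<forall>i. i \<notin> {i. S $ i $ i = 0} \<longrightarrow> x $ i = 0}"
proof (intro set_eqI iffI)
  fix x :: "real^'n"
  assume "x \<in> dual_kernel_std S"
  then obtain z where z: "x = std_vec z" "S *v z = 0" by (auto simp: dual_kernel_std_def)
  have "x $ i = 0" if "S $ i $ i \<noteq> 0" for i
  proof -
    have "S $ i $ i * z $ i = 0" using diagonal_mult_vec[OF diag, of z i] z(2) by simp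
    then show ?thesis using that z(1)
      by (cases "S $ i $ i"; cases "z $ i")
        (auto simp: std_vec_def times_dualnum_def zero_dualnum_def)
  qed
  then show "x \<in> {x. \<forall>i. i \<notin> {i. S $ i $ i = 0} \<longrightarrow> x $ i = 0}" by simp
next
  fix x :: "real^'n"
  assume "x \<in> {x. \<forall>i. i \<notin> {i. S $ i $ i = 0} \<longrightarrow> x $ i = 0}"
  then have "S $ i $ i * Dual (x $ i) 0 = 0" for i
    by (cases "S $ i $ i = 0") (auto simp: zero_dualnum_def times_dualnum_def)
  then have "S *v dual_vec x 0 = 0"
    by (simp add: vec_eq_iff diagonal_mult_vec[OF diag] dual_vec_def)
  then show "x \<in> dual_kernel_std S"
    unfolding dual_kernel_std_def by (intro image_eqI[of _ _ "dual_vec x 0"]) simp_all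
qed

lemma orthogonal_mult_eq_0_iff:
  fixes U :: "'a::comm_ring_1^'n^'n"
  assumes "orthogonal_matrix U"
  shows "U *v x = 0 \<longleftrightarrow> x = 0"
proof
  assume "U *v x = 0"
  then have "(transpose U ** U) *v x = 0" by (simp only: matrix_vector_mul_assoc[symmetric] matrix_vector_mult_0_right)
  then show "x = 0" using assms by (simp add: orthogonal_matrix_def)
qed simp

lemma dual_kernel_std_orthogonal:
  fixes S U V :: "dualnum^'n^'n"
  assumes U: "orthogonal_matrix U" and V: "orthogonal_matrix V"
  shows "dual_kernel_std (U ** S ** transpose V) = (*v) (std_mat V) ` dual_kernel_std S"
proof -
  have VV: "transpose V ** V = mat 1" "V ** transpose V = mat 1"
    using V by (auto simp: orthogonal_matrix_def)
  have "{z. (U ** S ** transpose V) *v z = 0} = (*v) V ` {z. S *v z = 0}"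
  proof (intro set_eqI iffI)
    fix z
    assume "z \<in> {z. (U ** S ** transpose V) *v z = 0}"
    then have "U *v (S *v (transpose V *v z)) = 0"
      by (simp only: mem_Collect_eq matrix_vector_mul_assoc matrix_mul_assoc)
    then have "S *v (transpose V *v z) = 0" using orthogonal_mult_eq_0_iff[OF U] by blast
    moreover have "z = V *v (transpose V *v z)"
      by (simp only: matrix_vector_mul_assoc VV matrix_vector_mul_lid)
    ultimately show "z \<in> (*v) V ` {z. S *v z = 0}" by blast
  next
    fix z
    assume "z \<in> (*v) V ` {z. S *v z = 0}"
    then obtain y where y: "z = V *v y" "S *v y = 0" by blast
    have "(U ** S ** transpose V) *v z = U *v (S *v ((transpose V ** V) *v y))"
      unfolding y(1) by (simp only: matrix_vector_mul_assoc matrix_mul_assoc)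
    then show "z \<in> {z. (U ** S ** transpose V) *v z = 0}" using y VV by simp
  qed
  then show ?thesis unfolding dual_kernel_std_def by (auto simp: image_image)
qed

lemma card_svd_nonzero:
  fixes X :: "dualnum^'n^'n"
  assumes "is_dual_svd X U S V"
  shows "card {i. S $ i $ i \<noteq> 0} + dim (dual_kernel_std X) = CARD('n)"
proof -
  have U: "orthogonal_matrix U" and V: "orthogonal_matrix V" and X: "X = U ** S ** transpose V"
    and diag: "\<And>i j. i \<noteq> j \<Longrightarrow> S $ i $ j = 0"
    using assms by (auto simp: is_dual_svd_def)
  have "inj ((*v) (std_mat V))"
    unfolding matrix_left_invertible_injective[symmetric]
    using std_mat_orthogonal[OF V] unfolding orthogonal_matrix_def by blast
  then have "dim (dual_kernel_std X) = dim (dual_kernel_std S)"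
    unfolding X dual_kernel_std_orthogonal[OF U V]
    by (intro dim_image_eq) (auto intro: inj_on_subset)
  also have "dual_kernel_std S = {x. \<forall>i. i \<notin> {i. S $ i $ i = 0} \<longrightarrow> x $ i = 0}"
    by (rule dual_kernel_std_diagonal) (rule diag)
  also have "dim \<dots> = card {i. S $ i $ i = 0}"
    unfolding dim_vec_eq[symmetric] by (rule dim_substandard_cart)
  finally have "dim (dual_kernel_std X) = card {i. S $ i $ i = 0}" .
  moreover have "CARD('n) = card {i. S $ i $ i \<noteq> 0} + card {i. S $ i $ i = 0}"
    using card_Un_disjoint[of "{i. S $ i $ i \<noteq> 0}" "{i. S $ i $ i = 0}"]
    by (auto simp: Un_def)
  ultimately show ?thesis by simp
qed

text \<open>Rank and nullity for dual matrices. As the dimension does not refer to a decomposition, the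
  number of nonzero singular values is the same in all of them, and the definite description
  defining the rank is justified.\<close>

lemma dual_rank_plus_dim_kernel:
  fixes X :: "dualnum^'n^'n"
  shows "dual_rank X + dim (dual_kernel_std X) = CARD('n)"
proof -
  obtain U S V where svd: "is_dual_svd X U S V" using exists_dual_svd by blast
  have "dual_rank X = card {i. S $ i $ i \<noteq> 0}"
    unfolding dual_rank_def
  proof (rule the_equality)
    show "\<exists>U' S' V'. is_dual_svd X U' S' V' \<and> card {i. S $ i $ i \<noteq> 0} = card {i. S' $ i $ i \<noteq> 0}"
      using svd by blast
    fix r
    assume "\<exists>U' S' V'. is_dual_svd X U' S' V' \<and> r = card {i. S' $ i $ i \<noteq> 0}"
    then show "r = card {i. S $ i $ i \<noteq> 0}"
      using card_svd_nonzero[OF svd] card_svd_nonzero[of X _ _ _] by fastforce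
  qed
  then show ?thesis using card_svd_nonzero[OF svd] by simp
qed

lemma rank_plus_dim_kernel:
  fixes A :: "real^'n^'n"
  shows "rank A + dim {x. A *v x = 0} = CARD('n)"
proof -
  have "{y \<in> UNIV. \<forall>x \<in> span (rows A). orthogonal x y} = {x. A *v x = 0}"
  proof (intro set_eqI iffI)
    fix y assume "y \<in> {y \<in> UNIV. \<forall>x \<in> span (rows A). orthogonal x y}"
    then have "A $ i \<bullet> y = 0" for i
      using span_base[of "row i A" "rows A"] by (auto simp: orthogonal_def rows_def row_def)
    then show "y \<in> {x. A *v x = 0}" by (simp add: vec_eq_iff matrix_vector_mul_component)
  next
    fix y assume "y \<in> {x. A *v x = 0}"
    then show "y \<in> {y \<in> UNIV. \<forall>x \<in> span (rows A). orthogonal x y}"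
      using orthogonal_nullspace_rowspace[of A y] by (auto simp: orthogonal_commute)
  qed
  then show ?thesis
    using dim_subspace_orthogonal_to_vectors[of "span (rows A)" UNIV]
    by (simp add: row_rank_def)
qed

text \<open>In terms of \<open>X = A + \<epsilon> B\<close>: \<open>B\<close> maps the kernel of \<open>A\<close> into the range of \<open>A\<close>, the known condition for
  existence of a dual Moore-Penrose inverse.\<close>

definition kernel_lifts :: "dualnum^'n^'n \<Rightarrow> bool" where
  "kernel_lifts X \<longleftrightarrow> (\<forall>x. std_mat X *v x = 0 \<longrightarrow> (\<exists>z. std_vec z = x \<and> X *v z = 0))"

lemma mult_dual_scalar:
  fixes X :: "dualnum^'n^'n"
  shows "X *v (c *s z) = c *s (X *v z)"
  by (simp add: vec_eq_iff matrix_vector_mult_def sum_distrib_left mult_ac)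

lemma subspace_dual_kernel_std: "subspace (dual_kernel_std X)"
  unfolding subspace_def
proof (intro conjI ballI allI)
  show "0 \<in> dual_kernel_std X"
    unfolding dual_kernel_std_def by (intro image_eqI[of _ _ 0]) simp_all
next
  fix x y
  assume "x \<in> dual_kernel_std X" "y \<in> dual_kernel_std X"
  then obtain z w where "x = std_vec z" "X *v z = 0" "y = std_vec w" "X *v w = 0"
    by (auto simp: dual_kernel_std_def)
  then show "x + y \<in> dual_kernel_std X"
    unfolding dual_kernel_std_def
    by (intro image_eqI[of _ _ "z + w"]) (simp_all add: matrix_vector_right_distrib std_vec_def vec_eq_iff)
next
  fix c x
  assume "x \<in> dual_kernel_std X"
  then obtain z where "x = std_vec z" "X *v z = 0"
    by (auto simp: dual_kernel_std_def)
  then show "c *\<^sub>R x \<in> dual_kernel_std X"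
    unfolding dual_kernel_std_def
    by (intro image_eqI[of _ _ "Dual c 0 *s z"]) (simp_all add: mult_dual_scalar std_vec_def vec_eq_iff)
qed

text \<open>The two ranks are complementary to the dimensions of nested spaces, the lifting part of the real
  kernel and the whole of it, so they agree iff the spaces do.\<close>

lemma app_rank_eq_dual_rank_iff: "app_rank X = dual_rank X \<longleftrightarrow> kernel_lifts X"
proof -
  have sub: "subspace {x. std_mat X *v x = 0}"
    by (simp add: subspace_def matrix_vector_right_distrib matrix_vector_mult_scaleR)
  have "app_rank X = dual_rank X \<longleftrightarrow> dim (dual_kernel_std X) = dim {x. std_mat X *v x = 0}"
    using dual_rank_plus_dim_kernel[of X] rank_plus_dim_kernel[of "std_mat X"]
    unfolding app_rank_def by linarith
  also have "\<dots> \<longleftrightarrow> dual_kernel_std X = {x. std_mat X *v x = 0}"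
    using subspace_dim_equal[OF subspace_dual_kernel_std sub dual_kernel_std_subset] by auto
  also have "\<dots> \<longleftrightarrow> {x. std_mat X *v x = 0} \<subseteq> dual_kernel_std X"
    using dual_kernel_std_subset[of X] by blast
  also have "\<dots> \<longleftrightarrow> kernel_lifts X"
    unfolding kernel_lifts_def dual_kernel_std_def by blast
  finally show ?thesis .
qed

text \<open>The infinitesimal error \<open>T x\<close> of a real kernel vector \<open>x\<close> is corrected by \<open>- Y T x\<close>, which is
  infinitesimal too.\<close>

lemma kernel_lifts_if_inner_inverse:
  assumes "T ** Y ** T = T"
  shows "kernel_lifts T"
  unfolding kernel_lifts_def
proof (intro allI impI)
  fix x
  assume x: "std_mat T *v x = 0"
  let ?z = "dual_vec x 0"
  have "T *v (?z - Y *v (T *v ?z)) = T *v ?z - (T ** Y ** T) *v ?z"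
    by (simp only: matrix_vector_mult_diff_distrib matrix_vector_mul_assoc matrix_mul_assoc)
  then have "T *v (?z - Y *v (T *v ?z)) = 0" using assms by simp
  moreover have "std_vec (?z - Y *v (T *v ?z)) = x" using x by simp
  ultimately show "\<exists>z. std_vec z = x \<and> T *v z = 0" by blast
qed

section \<open>Stabilisation of the powers and the dual index\<close>

lemma mat_pow_add: "mat_pow A (j + k) = mat_pow A j ** mat_pow A k"
  by (induction j) (simp_all add: matrix_mul_assoc)

lemma mat_pow_Suc_right: "mat_pow A (Suc k) = mat_pow A k ** A"
  using mat_pow_add[of A k 1] by simp

lemma std_mat_pow [simp]: "std_mat (mat_pow A k) = mat_pow (std_mat A) k"
  by (induction k) simp_all

lemma rank_mat_pow_Suc_le:
  fixes A :: "real^'n^'n"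
  shows "rank (mat_pow A (Suc k)) \<le> rank (mat_pow A k)"
  by (simp add: rank_mul_le_right)

lemma rank_mat_pow_mat_index:
  "rank (mat_pow A (mat_index A + 1)) = rank (mat_pow A (mat_index A))"
  unfolding mat_index_def
proof (rule LeastI_ex, rule ccontr)
  assume no: "\<nexists>s. rank (mat_pow A (s + 1)) = rank (mat_pow A s)"
  have "rank (mat_pow A s) + s \<le> rank (mat_pow A 0)" for s
  proof (induction s)
    case (Suc s)
    have "rank (mat_pow A (Suc s)) \<noteq> rank (mat_pow A s)" using no by auto
    then show ?case using Suc rank_mat_pow_Suc_le[of A s] by linarith
  qed simp
  from this[of "Suc (rank (mat_pow A 0))"] show False by linarith
qed

text \<open>Kernels of consecutive powers increase, so equality of ranks is equality of kernels, and one
  coincidence propagates to all later powers.\<close>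

lemma kernel_mat_pow_stable:
  assumes "mat_index A \<le> k" "mat_pow A k *v x = 0"
  shows "mat_pow A (mat_index A) *v x = 0"
proof -
  let ?p = "mat_index A" and ?K = "\<lambda>k. {x. mat_pow A k *v x = 0}"
  have sub: "subspace (?K k)" for k
    by (simp add: subspace_def matrix_vector_right_distrib matrix_vector_mult_scaleR)
  have "?K ?p \<subseteq> ?K (?p + 1)"
    by (auto simp: matrix_vector_mul_assoc[symmetric])
  moreover have "dim (?K ?p) = dim (?K (?p + 1))"
    using rank_plus_dim_kernel[of "mat_pow A ?p"] rank_plus_dim_kernel[of "mat_pow A (?p + 1)"]
      rank_mat_pow_mat_index[of A] by linarith
  ultimately have base: "?K ?p = ?K (?p + 1)"
    using subspace_dim_equal[OF sub[of ?p] sub[of "?p + 1"]] by simp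
  have step: "mat_pow A (Suc (?p + d)) *v x = 0 \<Longrightarrow> mat_pow A (?p + d) *v x = 0" for d x
  proof (induction d arbitrary: x)
    case 0
    then show ?case using base by auto
  next
    case (Suc d)
    then have "mat_pow A (Suc (?p + d)) *v (A *v x) = 0"
      by (simp only: matrix_vector_mul_assoc mat_pow_Suc_right[symmetric] add_Suc_right)
    from Suc.IH[OF this] show ?case
      by (simp only: matrix_vector_mul_assoc mat_pow_Suc_right[symmetric] add_Suc_right)
  qed
  have "mat_pow A (?p + d) *v x = 0 \<Longrightarrow> mat_pow A ?p *v x = 0" for d
    by (induction d) (use step in auto)
  then show ?thesis using assms by (metis le_add_diff_inverse)
qed

lemma kernel_mat_pow_Suc:
  assumes "mat_index A \<le> k" "mat_pow A (Suc k) *v x = 0"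
  shows "mat_pow A k *v x = 0"
proof -
  have "mat_pow A (mat_index A) *v x = 0"
    using kernel_mat_pow_stable[of A "Suc k" x] assms by simp
  moreover have "mat_pow A k = mat_pow A (k - mat_index A) ** mat_pow A (mat_index A)"
    using assms(1) mat_pow_add[of A "k - mat_index A" "mat_index A"] by simp
  ultimately show ?thesis by (simp add: matrix_vector_mul_assoc[symmetric])
qed

lemma range_mat_pow_stable:
  assumes "mat_index A \<le> j" "j \<le> k"
  shows "\<exists>y. mat_pow A j *v x = mat_pow A k *v y"
proof -
  have "{x. mat_pow A j *v x = 0} = {x. mat_pow A k *v x = 0}"
  proof (intro set_eqI iffI; unfold mem_Collect_eq)
    fix x assume "mat_pow A j *v x = 0"
    moreover have "mat_pow A k = mat_pow A (k - j) ** mat_pow A j"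
      using assms(2) mat_pow_add[of A "k - j" j] by simp
    ultimately show "mat_pow A k *v x = 0" by (simp add: matrix_vector_mul_assoc[symmetric])
  next
    fix x assume "mat_pow A k *v x = 0"
    then have "mat_pow A (mat_index A) *v x = 0"
      using kernel_mat_pow_stable[of A k x] assms by simp
    moreover have "mat_pow A j = mat_pow A (j - mat_index A) ** mat_pow A (mat_index A)"
      using assms(1) mat_pow_add[of A "j - mat_index A" "mat_index A"] by simp
    ultimately show "mat_pow A j *v x = 0" by (simp add: matrix_vector_mul_assoc[symmetric])
  qed
  then have "rank (mat_pow A k) = rank (mat_pow A j)"
    using rank_plus_dim_kernel[of "mat_pow A j"] rank_plus_dim_kernel[of "mat_pow A k"] by simp
  moreover have "range ((*v) (mat_pow A k)) \<subseteq> range ((*v) (mat_pow A j))"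
  proof -
    have "mat_pow A k *v y = mat_pow A j *v (mat_pow A (k - j) *v y)" for y
      using assms(2) mat_pow_add[of A j "k - j"] by (simp add: matrix_vector_mul_assoc)
    then show ?thesis by auto
  qed
  moreover have "subspace (range ((*v) (mat_pow A i)))" for i
    by (intro linear_subspace_image subspace_UNIV matrix_vector_mul_linear)
  ultimately have "range ((*v) (mat_pow A k)) = range ((*v) (mat_pow A j))"
    by (intro subspace_dim_equal) (simp_all add: rank_dim_range)
  then show ?thesis by (metis rangeE rangeI)
qed

text \<open>With \<open>p\<close> the appreciable index, let \<open>x\<close> be in the kernel of \<open>A\<^sub>0 ^ k\<close>, hence of \<open>A\<^sub>0 ^ p\<close>. Then
  \<open>A ^ p x\<close> is infinitesimal, and applying the remaining \<open>k - p \<ge> p\<close> factors moves it into the stable range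
  of \<open>A\<^sub>0 ^ k\<close>, where an infinitesimal change of \<open>x\<close> cancels it.\<close>

lemma kernel_lifts_mat_pow:
  assumes "2 * app_index A \<le> k"
  shows "kernel_lifts (mat_pow A k)"
  unfolding kernel_lifts_def
proof (intro allI impI)
  let ?p = "app_index A"
  fix x
  assume "std_mat (mat_pow A k) *v x = 0"
  then have "mat_pow (std_mat A) ?p *v x = 0"
    using kernel_mat_pow_stable[of "std_mat A" k x] assms by (simp add: app_index_def)
  then have "std_vec (mat_pow A ?p *v dual_vec x 0) = 0" by simp
  then obtain w where w: "mat_pow A ?p *v dual_vec x 0 = dual_vec 0 w" by (rule std_vec_eq_0E)
  have k: "mat_pow A k = mat_pow A (k - ?p) ** mat_pow A ?p"
    using assms mat_pow_add[of A "k - ?p" ?p] by simp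
  have "mat_pow A k *v dual_vec x 0 = dual_vec 0 (mat_pow (std_mat A) (k - ?p) *v w)"
    unfolding k matrix_vector_mul_assoc[symmetric] w by (simp add: mult_dual_vec_infinitesimal)
  moreover obtain y where "mat_pow (std_mat A) (k - ?p) *v w = mat_pow (std_mat A) k *v y"
    using range_mat_pow_stable[of "std_mat A" "k - ?p" k w] assms unfolding app_index_def by fastforce
  ultimately have "mat_pow A k *v (dual_vec x 0 - dual_vec 0 y) = 0"
    by (simp add: matrix_vector_mult_diff_distrib mult_dual_vec_infinitesimal)
  then show "\<exists>z. std_vec z = x \<and> mat_pow A k *v z = 0"
    by (intro exI[of _ "dual_vec x 0 - dual_vec 0 y"]) simp
qed

text \<open>The search set in the definition of the dual index contains \<open>max 1 (2 p)\<close>, so the least element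
  exists and has the defining properties.\<close>

lemma dual_index_properties:
  "1 \<le> dual_index A" "app_index A \<le> dual_index A" "kernel_lifts (mat_pow A (dual_index A))"
proof -
  let ?k = "max 1 (2 * app_index A)"
  have "kernel_lifts (mat_pow A ?k)" by (rule kernel_lifts_mat_pow) simp
  then have "1 \<le> ?k \<and> app_index A \<le> ?k \<and> ?k \<le> max 1 (2 * app_index A) \<and>
     app_rank (mat_pow A ?k) = dual_rank (mat_pow A ?k)"
    by (simp add: app_rank_eq_dual_rank_iff)
  then have "1 \<le> dual_index A \<and> app_index A \<le> dual_index A \<and>
     dual_index A \<le> max 1 (2 * app_index A) \<and>
     app_rank (mat_pow A (dual_index A)) = dual_rank (mat_pow A (dual_index A))"
    unfolding dual_index_def by (rule LeastI)
  then show "1 \<le> dual_index A" "app_index A \<le> dual_index A" "kernel_lifts (mat_pow A (dual_index A))"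
    by (simp_all add: app_rank_eq_dual_rank_iff)
qed

lemma dual_index_eq_1_iff: "dual_index T = 1 \<longleftrightarrow> app_index T \<le> 1 \<and> kernel_lifts T"
proof
  assume "dual_index T = 1"
  then show "app_index T \<le> 1 \<and> kernel_lifts T"
    using dual_index_properties[of T] by simp
next
  assume T: "app_index T \<le> 1 \<and> kernel_lifts T"
  then have "app_rank (mat_pow T 1) = dual_rank (mat_pow T 1)"
    by (simp add: app_rank_eq_dual_rank_iff)
  then have "dual_index T \<le> 1"
    unfolding dual_index_def using T by (intro Least_le) simp
  then show "dual_index T = 1" using dual_index_properties(1)[of T] by simp
qed

section \<open>Orthogonal projectors\<close>

definition diagonal_matrix :: "('n \<Rightarrow> 'a::zero) \<Rightarrow> 'a^'n^'n" where
  "diagonal_matrix d = (\<chi> i j. if i = j then d i else 0)"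

lemma diagonal_matrix_mult:
  "diagonal_matrix a ** diagonal_matrix b = diagonal_matrix (\<lambda>i. a i * b i :: 'a::comm_ring_1)"
  by (simp add: diagonal_matrix_def matrix_matrix_mult_def vec_eq_iff if_distrib[of "\<lambda>x. x * _"] cong: if_cong)

lemma transpose_diagonal_matrix [simp]: "transpose (diagonal_matrix d) = diagonal_matrix d"
  by (auto simp: diagonal_matrix_def transpose_def vec_eq_iff)

text \<open>The expansion \<open>(a + \<epsilon> b)\<^sup>-\<^sup>1 = a\<^sup>-\<^sup>1 - \<epsilon> b a\<^sup>-\<^sup>2\<close>; it is \<open>0\<close> for infinitesimal arguments because
  division by zero yields zero.\<close>

definition dual_inverse :: "dualnum \<Rightarrow> dualnum" where
  "dual_inverse x = Dual (1 / std_part x) (- inf_part x / (std_part x)\<^sup>2)"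

lemma mult_dual_inverse: "std_part x \<noteq> 0 \<Longrightarrow> x * dual_inverse x = 1"
  by (simp add: dual_inverse_def times_dualnum_def one_dualnum_def power2_eq_square)

text \<open>If \<open>X\<close> had an infinitesimal nonzero singular value, the standard part of the corresponding right
  singular vector would be a kernel vector of \<open>X\<^sub>0\<close> without lift. So all nonzero singular values are units
  and can be inverted, as in the construction of the real Moore-Penrose inverse; \<open>P\<close> is \<open>X\<close> times its
  Moore-Penrose inverse.\<close>

lemma exists_orthogonal_projector:
  fixes X :: "dualnum^'n^'n"
  assumes "kernel_lifts X"
  obtains P Y where "transpose P = P" "P ** P = P" "P ** X = X" "P = X ** Y"
proof -
  obtain U S V where "is_dual_svd X U S V" using exists_dual_svd by blast
  then have U: "transpose U ** U = mat 1" and V: "transpose V ** V = mat 1"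
    and U_orth: "orthogonal_matrix U"
    and X: "X = U ** S ** transpose V" and off: "\<And>i j. i \<noteq> j \<Longrightarrow> S $ i $ j = 0"
    by (auto simp: is_dual_svd_def orthogonal_matrix_def)
  define s where "s i = S $ i $ i" for i
  have S: "S = diagonal_matrix s"
    using off by (simp add: diagonal_matrix_def s_def vec_eq_iff)
  have unit: "std_part (s i) \<noteq> 0" if "s i \<noteq> 0" for i
  proof
    assume 0: "std_part (s i) = 0"
    let ?e = "axis i 1 :: real^'n"
    have VV: "transpose (std_mat V) ** std_mat V = mat 1"
      using arg_cong[OF V, of std_mat] by simp
    have "std_mat S *v ?e = 0"
      using 0 by (auto simp: vec_eq_iff matrix_vector_mult_basis column_def std_mat_def S diagonal_matrix_def)
    then have "std_mat X *v (std_mat V *v ?e) = 0"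
      by (simp add: X matrix_vector_mul_assoc matrix_mul_assoc[symmetric] VV)
        (simp add: matrix_vector_mul_assoc[symmetric])
    then obtain z where z: "std_vec z = std_mat V *v ?e" "X *v z = 0"
      using assms unfolding kernel_lifts_def by blast
    have "U *v (S *v (transpose V *v z)) = 0"
      using z(2) unfolding X by (simp only: matrix_vector_mul_assoc matrix_mul_assoc)
    then have "S *v (transpose V *v z) = 0" using orthogonal_mult_eq_0_iff[OF U_orth] by blast
    then have "s i * (transpose V *v z) $ i = 0"
      using diagonal_mult_vec[of S "transpose V *v z" i, OF off] unfolding s_def by (metis zero_index)
    moreover have "std_part ((transpose V *v z) $ i) = 1"
    proof -
      have "std_vec (transpose V *v z) = (transpose (std_mat V) ** std_mat V) *v ?e"
        unfolding std_vec_mult z std_mat_transpose matrix_vector_mul_assoc ..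
      then have "std_vec (transpose V *v z) = ?e" unfolding VV by simp
      then have "std_vec (transpose V *v z) $ i = ?e $ i" by simp
      then show ?thesis by (simp add: std_vec_def)
    qed
    ultimately have "s i = 0" using 0
      by (cases "s i") (auto simp: times_dualnum_def zero_dualnum_def)
    then show False using that by simp
  qed
  define E where "E = diagonal_matrix (\<lambda>i. if s i = 0 then 0 else 1 :: dualnum)"
  define R where "R = diagonal_matrix (\<lambda>i. dual_inverse (s i))"
  have ES: "E ** S = S"
    unfolding E_def S diagonal_matrix_mult by (rule arg_cong[of _ _ diagonal_matrix]) auto
  have SR: "S ** R = E"
    unfolding E_def R_def S diagonal_matrix_mult
    by (rule arg_cong[of _ _ diagonal_matrix]) (auto simp: mult_dual_inverse unit)
  have EE: "E ** E = E"
    unfolding E_def diagonal_matrix_mult by (rule arg_cong[of _ _ diagonal_matrix]) auto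
  have sandwich: "U ** Z ** transpose W ** (W ** Z' ** W') = U ** (Z ** Z') ** W'"
    if "transpose W ** W = mat 1" for Z Z' W W' :: "dualnum^'n^'n"
  proof -
    have "U ** Z ** transpose W ** (W ** Z' ** W') = U ** Z ** (transpose W ** W) ** Z' ** W'"
      by (simp only: matrix_mul_assoc)
    then show ?thesis using that by (simp add: matrix_mul_assoc)
  qed
  show thesis
  proof
    show "transpose (U ** E ** transpose U) = U ** E ** transpose U"
      by (simp add: matrix_transpose_mul matrix_mul_assoc E_def)
    show "U ** E ** transpose U ** (U ** E ** transpose U) = U ** E ** transpose U"
      by (simp add: sandwich[OF U] EE)
    show "U ** E ** transpose U ** X = X"
      unfolding X by (simp add: sandwich[OF U] ES)
    show "U ** E ** transpose U = X ** (V ** R ** transpose U)"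
      unfolding X by (simp add: sandwich[OF V] SR)
  qed
qed

section \<open>The core-EP decomposition\<close>

lemma std_mat_add [simp]: "std_mat (A + B) = std_mat A + std_mat B"
  by (simp add: std_mat_def vec_eq_iff)

lemma std_mat_diff [simp]: "std_mat (A - B) = std_mat A - std_mat B"
  by (simp add: std_mat_def vec_eq_iff minus_dualnum_def)

lemma matrix_diff_distrib:
  fixes A B C :: "'a::ring_1^'n^'n"
  shows "A ** (B - C) = A ** B - A ** C" "(B - C) ** A = B ** A - C ** A"
  by (simp_all add: matrix_matrix_mult_def vec_eq_iff sum_subtractf algebra_simps)

lemma matrix_add_rdistrib:
  fixes A B C :: "'a::ring_1^'n^'n"
  shows "(B + C) ** A = B ** A + C ** A"
  by (simp add: matrix_matrix_mult_def vec_eq_iff sum.distrib algebra_simps)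

lemma matrix_mult_minus:
  fixes A B :: "'a::ring_1^'n^'n"
  shows "A ** (- B) = - (A ** B)"
  by (simp add: matrix_matrix_mult_def vec_eq_iff sum_negf)

text \<open>With \<open>L\<close> inverse to the standard part \<open>K\<^sub>0\<close>, the inverse of \<open>K\<^sub>0 + \<epsilon> K\<^sub>1\<close> is the truncated
  geometric series \<open>L - \<epsilon> L K\<^sub>1 L\<close>.\<close>

lemma dual_right_inverse:
  fixes K :: "dualnum^'n^'n"
  assumes "\<And>x. std_mat K *v x = 0 \<Longrightarrow> x = 0"
  shows "\<exists>L. K ** L = mat 1"
proof -
  obtain L where "L ** std_mat K = mat 1"
    using assms matrix_left_invertible_ker[of "std_mat K"] by blast
  then have L: "std_mat K ** L = mat 1" by (metis matrix_left_right_inverse)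
  have "dual_mat (std_mat K) (inf_mat K) ** dual_mat L (- (L ** (inf_mat K ** L))) = mat 1"
    by (simp add: dual_mat_mult dual_mat_one matrix_mult_minus matrix_mul_assoc L
        del: dual_mat_std_inf)
  then show ?thesis by auto
qed

text \<open>\<open>B\<close> acts bijectively on the range of \<open>P\<close>, and \<open>G\<close> is the inverse of this action, extended by some
  map into the range. It suffices that \<open>K\<close>, which is \<open>B\<close> on the range and the identity on the
  complement, has an injective standard part; that is the stabilisation of the real kernels.\<close>

lemma invertible_on_range:
  fixes B :: "dualnum^'n^'n"
  assumes PP: "P ** P = P" and PX: "P ** mat_pow B j = mat_pow B j" and PY: "P = mat_pow B j ** Y"
    and ker: "\<And>x. mat_pow (std_mat B) (Suc j) *v x = 0 \<Longrightarrow> mat_pow (std_mat B) j *v x = 0"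
  obtains G where "P ** G = G" "B ** G = P" "P ** B ** P = B ** P"
proof -
  have BP: "B ** P = mat_pow B j ** B ** Y"
    unfolding PY matrix_mul_assoc using mat_pow_Suc_right[of B j] by simp
  have PBP: "P ** B ** P = B ** P"
  proof -
    have "P ** B ** P = P ** (B ** P)" by (simp only: matrix_mul_assoc)
    also have "\<dots> = (P ** mat_pow B j) ** B ** Y" unfolding BP by (simp only: matrix_mul_assoc)
    finally show ?thesis unfolding PX BP .
  qed
  define K where "K = B ** P + (mat 1 - P)"
  have PK: "P ** K = B ** P"
    unfolding K_def by (simp add: matrix_add_ldistrib matrix_diff_distrib matrix_mul_assoc PBP PP)
  have "x = 0" if x: "std_mat K *v x = 0" for x
  proof -
    let ?B = "std_mat B" and ?P = "std_mat P" and ?Y = "std_mat Y"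
    have "(?B ** ?P) *v x = std_mat (P ** K) *v x" unfolding PK by simp
    also have "\<dots> = ?P *v (std_mat K *v x)" by (simp add: matrix_vector_mul_assoc)
    finally have BPx: "(?B ** ?P) *v x = 0" using x by simp
    then have "x = ?P *v x"
      using x unfolding K_def
      by (simp add: matrix_vector_mult_add_rdistrib matrix_vector_mult_diff_rdistrib)
    moreover have P: "?P *v x = mat_pow ?B j *v (?Y *v x)"
      using PY by (metis std_mat_mult std_mat_pow matrix_vector_mul_assoc)
    moreover have "mat_pow ?B (Suc j) *v (?Y *v x) = 0"
      using BPx by (simp add: matrix_vector_mul_assoc[symmetric] P)
    ultimately show "x = 0" using ker by metis
  qed
  then obtain L where L: "K ** L = mat 1" using dual_right_inverse by blast
  show thesis
  proof
    show "P ** (P ** L) = P ** L" by (simp add: matrix_mul_assoc PP)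
    have "B ** (P ** L) = P ** (K ** L)" by (simp add: matrix_mul_assoc PK)
    then show "B ** (P ** L) = P" by (simp add: L)
    show "P ** B ** P = B ** P" by (fact PBP)
  qed
qed

text \<open>\<open>G\<close> is an inner inverse of \<open>T\<close>, which gives the lifting property, and \<open>T = T\<^sup>2 G\<^sup>2 T\<close>, which bounds the
  rank of \<open>T\<^sub>0\<close> by that of \<open>T\<^sub>0\<^sup>2\<close>.\<close>

lemma core_part_index_1:
  fixes T :: "dualnum^'n^'n"
  assumes "T ** G = P" "P ** G = G" "P ** T = T"
  shows "dual_index T = 1"
proof -
  have TGT: "T ** G ** T = T" using assms by simp
  have "T ** T ** (G ** G ** T) = T ** (T ** G) ** G ** T" by (simp only: matrix_mul_assoc)
  also have "\<dots> = T ** (P ** G) ** T" unfolding assms(1) by (simp only: matrix_mul_assoc)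
  also have "\<dots> = T" using assms by simp
  finally have "std_mat T = std_mat (T ** T ** (G ** G ** T))" by simp
  then have "std_mat T = (std_mat T ** std_mat T) ** std_mat (G ** G ** T)" by simp
  then have "rank (std_mat T) \<le> rank (std_mat T ** std_mat T)" by (metis rank_mul_le_left)
  moreover have "rank (std_mat T ** std_mat T) \<le> rank (std_mat T)" by (rule rank_mul_le_left)
  ultimately have "rank (mat_pow (std_mat T) (1 + 1)) = rank (mat_pow (std_mat T) 1)" by simp
  then have "app_index T \<le> 1"
    unfolding app_index_def mat_index_def by (rule Least_le)
  then show ?thesis using kernel_lifts_if_inner_inverse[OF TGT] unfolding dual_index_eq_1_iff by blast
qed

theorem theorem4p2:
  fixes A :: "dualnum^'n^'n" and m :: nat
  assumes "dual_index A = m"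
  shows "\<exists>!TN. case TN of (T, N) \<Rightarrow>
           A = T + N \<and>
           dual_index T = 1 \<and>
           mat_pow N m = 0 \<and>
           transpose T ** N = 0 \<and> N ** T = 0"
proof -
  have m: "1 \<le> m" "app_index A \<le> m" "kernel_lifts (mat_pow A m)"
    using dual_index_properties[of A] assms by auto
  obtain P Y where Pt: "transpose P = P" and PP: "P ** P = P"
    and PX: "P ** mat_pow A m = mat_pow A m" and PY: "P = mat_pow A m ** Y"
    using exists_orthogonal_projector[OF m(3)] .
  obtain G where G: "P ** G = G" "A ** G = P" and PAP: "P ** A ** P = A ** P"
    by (rule invertible_on_range[OF PP PX PY])
      (use kernel_mat_pow_Suc m(2) in \<open>auto simp: app_index_def\<close>)
  show ?thesis
  proof (rule ex1I[of _ "(P ** A, A - P ** A)"]; (unfold prod.case)?)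
    have "dual_index (P ** A) = 1"
    proof (rule core_part_index_1)
      have "P ** A ** G = P ** (A ** G)" by (simp only: matrix_mul_assoc)
      then show "P ** A ** G = P" by (simp add: G PP)
    qed (simp_all add: G PP matrix_mul_assoc)
    moreover have "mat_pow (A - P ** A) m = 0"
    proof -
      \<comment> \<open>\<open>((1 - P) A) ^ k = (1 - P) A ^ k\<close> for positive \<open>k\<close>, as \<open>(1 - P) A P = 0\<close>.\<close>
      have "mat_pow (A - P ** A) (Suc k) = mat_pow A (Suc k) - P ** mat_pow A (Suc k)" for k
      proof (induction k)
        case (Suc k)
        have "mat_pow (A - P ** A) (Suc (Suc k)) =
            (A - P ** A) ** (mat_pow A (Suc k) - P ** mat_pow A (Suc k))"
          using Suc by simp
        also have "\<dots> = A ** mat_pow A (Suc k) - P ** A ** mat_pow A (Suc k)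
            - (A ** P ** mat_pow A (Suc k) - P ** A ** P ** mat_pow A (Suc k))"
          by (simp only: matrix_diff_distrib matrix_mul_assoc)
        also have "\<dots> = mat_pow A (Suc (Suc k)) - P ** mat_pow A (Suc (Suc k))"
          unfolding PAP by (simp add: matrix_mul_assoc)
        finally show ?case .
      qed simp
      from this[of "m - 1"] show ?thesis using m(1) PX by simp
    qed
    moreover have "transpose (P ** A) ** (A - P ** A) = 0"
    proof -
      have "transpose (P ** A) ** (A - P ** A) =
          transpose A ** P ** A - transpose A ** (P ** P) ** A"
        by (simp only: matrix_transpose_mul Pt matrix_diff_distrib matrix_mul_assoc)
      then show ?thesis by (simp add: PP)
    qed
    moreover have "(A - P ** A) ** (P ** A) = 0"
    proof -
      have "(A - P ** A) ** (P ** A) = A ** P ** A - P ** A ** P ** A"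
        by (simp only: matrix_diff_distrib matrix_mul_assoc)
      then show ?thesis by (simp add: PAP)
    qed
    ultimately show "A = P ** A + (A - P ** A) \<and> dual_index (P ** A) = 1 \<and>
        mat_pow (A - P ** A) m = 0 \<and> transpose (P ** A) ** (A - P ** A) = 0 \<and>
        (A - P ** A) ** (P ** A) = 0"
      by simp
  next
    fix TN
    assume TN: "case TN of (T, N) \<Rightarrow> A = T + N \<and> dual_index T = 1 \<and> mat_pow N m = 0 \<and>
      transpose T ** N = 0 \<and> N ** T = 0"
    obtain T N where TN_eq: "TN = (T, N)" by (cases TN)
    have A: "A = T + N" and T: "app_index T \<le> 1" "kernel_lifts T" and Nm: "mat_pow N m = 0"
      and TtN: "transpose T ** N = 0" and NT: "N ** T = 0"
      using TN unfolding TN_eq prod.case dual_index_eq_1_iff by blast+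
    obtain Q W where Qt: "transpose Q = Q" and QQ: "Q ** Q = Q" and QT: "Q ** T = T"
      and QW: "Q = T ** W"
      using exists_orthogonal_projector[OF T(2)] .
    obtain H where H: "Q ** H = H" "T ** H = Q"
    proof (rule invertible_on_range[of Q T 1 W])
      show "mat_pow (std_mat T) 1 *v x = 0" if "mat_pow (std_mat T) (Suc 1) *v x = 0" for x
        using kernel_mat_pow_Suc[of "std_mat T" 1 x] T(1) that by (simp add: app_index_def)
    qed (use QQ QT QW in auto)
    \<comment> \<open>\<open>T\<close> is a right multiple of its square, so it is one of each of its powers.\<close>
    have TT: "T ** T ** (W ** H ** T) = T"
    proof -
      have "T ** T ** (W ** H ** T) = T ** (Q ** H) ** T" unfolding QW by (simp only: matrix_mul_assoc)
      then show ?thesis by (simp add: H QT)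
    qed
    have AT: "A ** T = T ** T" by (simp add: A matrix_add_rdistrib NT)
    have "\<exists>Z. T = mat_pow A k ** T ** Z" for k
    proof (induction k)
      case 0
      show ?case by (auto intro: exI[of _ "mat 1"])
    next
      case (Suc k)
      then obtain Z where Z: "T = mat_pow A k ** T ** Z" by blast
      have "T = mat_pow A k ** (T ** T ** (W ** H ** T)) ** Z" using Z by (simp add: TT)
      also have "\<dots> = mat_pow A k ** A ** T ** (W ** H ** T ** Z)"
        unfolding AT[symmetric] by (simp only: matrix_mul_assoc)
      finally show ?case unfolding mat_pow_Suc_right by blast
    qed
    then obtain Z where "T = mat_pow A m ** T ** Z" by blast
    then have "P ** T = T" using PX by (metis matrix_mul_assoc)
    then have "P ** Q = Q" unfolding QW by (simp add: matrix_mul_assoc)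
    have "\<exists>Z. mat_pow A k = T ** Z + mat_pow N k" for k
    proof (induction k)
      case 0
      show ?case by (auto intro: exI[of _ 0])
    next
      case (Suc k)
      then obtain Z where Z: "mat_pow A k = T ** Z + mat_pow N k" by blast
      have "mat_pow A (Suc k) = T ** mat_pow A k + N ** (T ** Z + mat_pow N k)"
        using Z by (simp add: A matrix_add_rdistrib)
      also have "\<dots> = T ** mat_pow A k + (N ** T) ** Z + mat_pow N (Suc k)"
        by (simp add: matrix_add_ldistrib matrix_mul_assoc)
      finally show ?case by (auto simp: NT)
    qed
    then obtain Z where "mat_pow A m = T ** Z" using Nm by (metis add.right_neutral)
    then have "Q ** mat_pow A m = mat_pow A m" by (simp add: matrix_mul_assoc QT)
    then have "Q ** P = P" unfolding PY by (simp add: matrix_mul_assoc)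
    then have "P = transpose (Q ** P)" by (simp add: Pt)
    also have "\<dots> = Q" using \<open>P ** Q = Q\<close> by (simp add: matrix_transpose_mul Pt Qt)
    finally have "P = Q" .
    have "Q ** N = transpose (T ** W) ** N" using Qt QW by simp
    also have "\<dots> = transpose W ** (transpose T ** N)" by (simp add: matrix_transpose_mul matrix_mul_assoc)
    finally have "Q ** N = 0" by (simp add: TtN)
    then have "P ** A = T" unfolding \<open>P = Q\<close> by (simp add: A matrix_add_ldistrib QT)
    then show "TN = (P ** A, A - P ** A)" by (simp add: TN_eq A)
  qed
qed

end
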